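(* Let $k\ge1$ and let $A_i,B_{i1},\ldots,B_{ik}\in\mathbb{C}^{m_i\times n_i}$ with $m_i\ge n_i$ for $1\le i\le k$. For each $i$ let $[A_i,B_{i1},\ldots,B_{ik}]=U^i\Sigma^i(V^i)^{H}$ be an SVD partitioned as in the context, and set $\widetilde A_i=(V_{11}^i)^{H}$, $\widetilde B_{is}=(V_{s+1\,1}^i)^{H}\in\mathbb{C}^{n_i\times n_i}$ for $1\le s\le k$. Consider the two problems, for unknown $\lambda_1,\ldots,\lambda_k\in\mathbb{C}$ and nonzero $\mathbf{x}_i\in\mathbb{C}^{n_i}$ ($1\le i\le k$): (RMEP) $A_i\mathbf{x}_i=\lambda_1B_{i1}\mathbf{x}_i+\cdots+\lambda_kB_{ik}\mathbf{x}_i$ for $1\le i\le k$; (MEP) $\widetilde A_i\mathbf{x}_i=\lambda_1\widetilde B_{i1}\mathbf{x}_i+\cdots+\lambda_k\widetilde B_{ik}\mathbf{x}_i$ for $1\le i\le k$. Then: 1. If $\operatorname{rank}([A_i,B_{i1},\ldots,B_{ik}])\le n_i$ for $1\le i\le k$, then any solution $(\lambda_1,\ldots,\lambda_k,\mathbf{x}_1,\ldots,\mathbf{x}_k)$ of (MEP) is a solution of (RMEP). 2. If $\operatorname{rank}([A_i,B_{i1},\ldots,B_{ik}])\ge n_i$ for $1\le i\le k$, then any solution of (RMEP) is a solution of (MEP). 3. In particular, if $\operatorname{rank}([A_i,B_{i1},\ldots,B_{ik}])=n_i$ for $1\le i\le k$, then (MEP) and (RMEP) have the same set of solutions.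
   Context: Notation: $M^{H}$ is the conjugate transpose and $[M_0,\ldots,M_k]$ denotes horizontal concatenation. SVD partition: with $\widetilde m_i=\min\{m_i,(k+1)n_i\}$, $U^i=[U_1^i,U_2^i]\in\mathbb{C}^{m_i\times\widetilde m_i}$ has orthonormal columns, with $U_1^i\in\mathbb{C}^{m_i\times n_i}$; $V^i\in\mathbb{C}^{(k+1)n_i\times(k+1)n_i}$ is unitary; $\Sigma^i=\begin{bmatrix}\Sigma_1^i&0\\0&\Sigma_2^i\end{bmatrix}\in\mathbb{R}^{\widetilde m_i\times(k+1)n_i}$, where $\Sigma_1^i\in\mathbb{R}^{n_i\times n_i}$ is diagonal containing the $n_i$ largest singular values of $[A_i,B_{i1},\ldots,B_{ik}]$ and $\Sigma_2^i\in\mathbb{R}^{(\widetilde m_i-n_i)\times kn_i}$ carries the remaining singular values on its main diagonal and is zero elsewhere. $V^i$ is partitioned into $k+1$ block rows of $n_i$ rows each, and two block columns of $n_i$ and $kn_i$ columns: the blocks of the $r$th block row are $V^i_{r1}\in\mathbb{C}^{n_i\times n_i}$ and $V^i_{r2}\in\mathbb{C}^{n_i\times kn_i}$, $1\le r\le k+1$ (so $V^i_{s+1\,1}$ is the block with $r=s+1$ in the first block column). *)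

theory Defs
  imports
    "HOL-Library.FuncSet"
    "Jordan_Normal_Form.DL_Rank"
    "Jordan_Normal_Form.Schur_Decomposition"
begin

definition hconcat :: "nat \<Rightarrow> 'a mat list \<Rightarrow> 'a mat" where
  "hconcat nr Ms = mat_of_cols nr (concat (map cols Ms))"

text \<open>The matrix \<open>[A, B 1, \<dots>, B k]\<close> with \<open>m\<close> rows.\<close>

definition coeff_mat :: "nat \<Rightarrow> nat \<Rightarrow> 'a mat \<Rightarrow> (nat \<Rightarrow> 'a mat) \<Rightarrow> 'a mat" where
  "coeff_mat m k A B = hconcat m (A # map B [1..<Suc k])"

definition orthonormal_cols :: "complex mat \<Rightarrow> bool" where
  "orthonormal_cols U \<longleftrightarrow> mat_adjoint U * U = 1\<^sub>m (dim_col U)"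

definition unitary_mat :: "nat \<Rightarrow> complex mat \<Rightarrow> bool" where
  "unitary_mat d V \<longleftrightarrow> V \<in> carrier_mat d d \<and>
     mat_adjoint V * V = 1\<^sub>m d \<and> V * mat_adjoint V = 1\<^sub>m d"

text \<open>
  \<open>M = [U1, U2] * diag(S1, S2) * V\<^sup>H\<close> is a singular value decomposition in economy form
  (\<open>U\<close> has \<open>min m ((k+1) n)\<close> columns), partitioned so that \<open>S1\<close> contains the \<open>n\<close> largest
  singular values. \<open>S2\<close> is rectangular in general. The singular values are not required to
  be sorted within \<open>S1\<close> or within \<open>S2\<close>.
\<close>

definition partitioned_svd ::
  "nat \<Rightarrow> nat \<Rightarrow> nat \<Rightarrow> complex mat \<Rightarrow> complex mat \<Rightarrow> complex mat \<Rightarrow>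
   real mat \<Rightarrow> real mat \<Rightarrow> complex mat \<Rightarrow> bool" where
  "partitioned_svd m n k M U1 U2 S1 S2 V \<longleftrightarrow>
    (let mt = min m ((k + 1) * n);
         U = hconcat m [U1, U2];
         S = four_block_mat S1 (0\<^sub>m n (k * n)) (0\<^sub>m (mt - n) n) S2
     in U1 \<in> carrier_mat m n \<and> U2 \<in> carrier_mat m (mt - n) \<and> orthonormal_cols U \<and>
        S1 \<in> carrier_mat n n \<and> diagonal_mat S1 \<and>
        S2 \<in> carrier_mat (mt - n) (k * n) \<and> diagonal_mat S2 \<and>
        (\<forall>j<n. 0 \<le> S1 $$ (j,j)) \<and> (\<forall>l<mt - n. 0 \<le> S2 $$ (l,l)) \<and>
        (\<forall>j<n. \<forall>l<mt - n. S2 $$ (l,l) \<le> S1 $$ (j,j)) \<and>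
        unitary_mat ((k + 1) * n) V \<and>
        M = U * map_mat complex_of_real S * mat_adjoint V)"

text \<open>
  The \<open>n \<times> n\<close> block in the \<open>r\<close>-th block row (counted from 1) and the first block column of \<open>V\<close>.
\<close>

definition first_col_block :: "nat \<Rightarrow> nat \<Rightarrow> 'a mat \<Rightarrow> 'a mat" where
  "first_col_block n r V = mat n n (\<lambda>(a, b). V $$ ((r - 1) * n + a, b))"

text \<open>
  The solutions \<open>(\<lambda>\<^sub>1, \<dots>, \<lambda>\<^sub>k, x\<^sub>1, \<dots>, x\<^sub>k)\<close> of
  \<open>A\<^sub>i x\<^sub>i = \<lambda>\<^sub>1 B\<^sub>i\<^sub>1 x\<^sub>i + \<dots> + \<lambda>\<^sub>k B\<^sub>i\<^sub>k x\<^sub>i\<close>, \<open>1 \<le> i \<le> k\<close>, with all \<open>x\<^sub>i\<close> nonzero, where the \<open>i\<close>-th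
  coefficient matrices are \<open>p i \<times> q i\<close>. Tuples are extensional functions on \<open>{1..k}\<close>, so that
  a set of solutions is not affected by junk values at other indices.
\<close>

definition mep_solutions ::
  "nat \<Rightarrow> (nat \<Rightarrow> nat) \<Rightarrow> (nat \<Rightarrow> nat) \<Rightarrow> (nat \<Rightarrow> complex mat) \<Rightarrow> (nat \<Rightarrow> nat \<Rightarrow> complex mat) \<Rightarrow>
   ((nat \<Rightarrow> complex) \<times> (nat \<Rightarrow> complex vec)) set" where
  "mep_solutions k p q A B =
    {(lam, x). lam \<in> {1..k} \<rightarrow>\<^sub>E UNIV \<and>
       x \<in> (\<Pi>\<^sub>E i\<in>{1..k}. carrier_vec (q i) - {0\<^sub>v (q i)}) \<and>
       (\<forall>i\<in>{1..k}. A i *\<^sub>v x i =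
          finsum_vec TYPE(complex) (p i) (\<lambda>s. lam s \<cdot>\<^sub>v (B i s *\<^sub>v x i)) {1..k})}"

end

theory Submission
  imports Defs
begin

text \<open>
  Write \<open>M = [A, B\<^sub>1, \<dots>, B\<^sub>k] = U \<Sigma> V\<^sup>H\<close> and stack \<open>z = (x, - \<lambda>\<^sub>1 x, \<dots>, - \<lambda>\<^sub>k x)\<close>. The rectangular
  equation says \<open>M z = 0\<close>; the square one says that the first \<open>n\<close> coordinates of
  \<open>w = V\<^sup>H z\<close> vanish. Since \<open>U\<close> is injective, \<open>M z = 0\<close> is equivalent to
  \<open>\<sigma>\<^sub>j w\<^sub>j = 0\<close> for all \<open>j\<close>. The rank of \<open>M\<close> is the number of nonzero \<open>\<sigma>\<^sub>j\<close>, and the first \<open>n\<close>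
  of these dominate the others: rank at most \<open>n\<close> forces \<open>\<sigma>\<^sub>j = 0\<close> for \<open>j > n\<close>, and rank at
  least \<open>n\<close> forces \<open>\<sigma>\<^sub>j \<noteq> 0\<close> for \<open>j \<le> n\<close>.
\<close>

section \<open>Rank bounds for matrix products\<close>

lemma mult_mat_unit_vec:
  fixes A :: "'a :: semiring_1 mat"
  assumes "A \<in> carrier_mat nr nc" "j < nc"
  shows "A *\<^sub>v unit_vec nc j = col A j"
  using assms by (intro eq_vecI) auto

context vec_space
begin

lemma cols_mult_subset_span:
  assumes X: "X \<in> carrier_mat n r" and Y: "Y \<in> carrier_mat r nc"
  shows "set (cols (X * Y)) \<subseteq> span (set (cols X))"
proof
  fix v assume "v \<in> set (cols (X * Y))"
  then obtain j where j: "j < nc" and v: "v = col (X * Y) j"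
    using Y by (auto simp: cols_def)
  have "v = X *\<^sub>v col Y j" unfolding v using col_mult2[OF X Y j] .
  moreover have "X *\<^sub>v col Y j \<in> carrier_vec n" using X Y j by simp
  moreover have "col Y j \<in> carrier_vec r" using Y j by simp
  ultimately have "v \<in> col_space X" using X unfolding col_space_eq[OF X] by auto
  then show "v \<in> span (set (cols X))" unfolding col_space_def .
qed

text \<open>The columns of \<open>X * Y\<close> lie in the span of the \<open>r\<close> columns of
  \<open>X\<close>, so by Steinitz exchange no independent set of them exceeds
  \<open>r\<close>.\<close>

lemma rank_mult_le_inner_dim:
  assumes X: "X \<in> carrier_mat n r" and Y: "Y \<in> carrier_mat r nc"
  shows "rank (X * Y) \<le> r"
proof -
  have XY: "X * Y \<in> carrier_mat n nc" using X Y by simp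
  \<comment> \<open>Extending the independent empty set yields a maximal independent set of columns,
    whose cardinality is the rank.\<close>
  obtain S where S: "maximal S (\<lambda>T. T \<subseteq> set (cols (X * Y)) \<and> lin_indpt T)"
    and fin: "finite S"
    using maximal_exists_superset[of "set (cols (X * Y))"
        "\<lambda>T. T \<subseteq> set (cols (X * Y)) \<and> lin_indpt T" "{}"] lin_dep_def by auto
  have sub: "S \<subseteq> set (cols (X * Y))" and li: "lin_indpt S"
    using S unfolding maximal_def by auto
  have "S \<subseteq> span (set (cols X))" using sub cols_mult_subset_span[OF X Y] by blast
  moreover have "set (cols X) \<subseteq> carrier_vec n" using X cols_dim by blast
  \<comment> \<open>The exchange set \<open>C\<close> itself is irrelevant: its cardinality being
    nonnegative gives the bound on \<open>card S\<close>.\<close>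
  ultimately obtain C :: "'a vec set" where "int (card C) \<le> int (card (set (cols X))) - int (card S)"
    using replacement[OF fin _ _ li, of "set (cols X)"] by auto
  then have "card S \<le> card (set (cols X))" by linarith
  also have "\<dots> \<le> r" using X card_length[of "cols X"] by simp
  finally show ?thesis using rank_card_indpt[OF XY S] by simp
qed

text \<open>An injective \<open>X * Y\<close> has \<open>r\<close> independent columns, all in the
  column space of \<open>X\<close>. This is the lower bound that matches the previous upper
  bound.\<close>

lemma inj_mult_le_rank:
  assumes X: "X \<in> carrier_mat n nc" and Y: "Y \<in> carrier_mat nc r"
    and inj: "\<And>v. v \<in> carrier_vec r \<Longrightarrow> (X * Y) *\<^sub>v v = 0\<^sub>v n \<Longrightarrow> v = 0\<^sub>v r"
  shows "r \<le> rank X"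
proof -
  have XY: "X * Y \<in> carrier_mat n r" using X Y by simp
  \<comment> \<open>Passing to the set of columns would merge repeated ones, so distinctness is
    needed both for independence and for counting \<open>r\<close> elements.\<close>
  have dist: "distinct (cols (X * Y))"
    unfolding distinct_conv_nth
  proof (intro allI impI notI)
    fix i j assume "i < length (cols (X * Y))" "j < length (cols (X * Y))" and ij: "i \<noteq> j"
      and eq: "cols (X * Y) ! i = cols (X * Y) ! j"
    then have i: "i < r" and j: "j < r" using XY by auto
    have "cols (X * Y) ! i = col (X * Y) i" "cols (X * Y) ! j = col (X * Y) j"
      by (rule cols_nth, use X Y i j in simp)+
    with eq have ceq: "col (X * Y) i = col (X * Y) j" by simp
    \<comment> \<open>If columns \<open>i\<close> and \<open>j\<close> coincide, the difference of
      the two unit vectors is a nonzero kernel vector.\<close>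
    define v :: "'a vec" where "v = unit_vec r i - unit_vec r j"
    have v: "v \<in> carrier_vec r" unfolding v_def by simp
    have "(X * Y) *\<^sub>v v = (X * Y) *\<^sub>v unit_vec r i - (X * Y) *\<^sub>v unit_vec r j"
      unfolding v_def by (rule mult_minus_distrib_mat_vec[OF XY]) auto
    also have "\<dots> = col (X * Y) i - col (X * Y) j"
      using mult_mat_unit_vec[OF XY i] mult_mat_unit_vec[OF XY j] by simp
    also have "\<dots> = 0\<^sub>v n" unfolding ceq using X by (intro eq_vecI) auto
    finally have "v = 0\<^sub>v r" using inj[OF v] by blast
    then have "v $ i = 0" using i by simp
    then show False unfolding v_def using i j ij by simp
  qed
  have li: "lin_indpt (set (cols (X * Y)))"
    using lin_depE[OF XY _ dist] inj by blast
  note sub = cols_mult_subset_span[OF X Y]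
  have cX: "set (cols X) \<subseteq> carrier_vec n" using X cols_dim by blast
  have subm: "submodule class_ring (span (set (cols X))) V" by (rule span_is_submodule[OF cX])
  have vs: "vectorspace class_ring (span_vs (set (cols X)))"
    by (rule subspace_is_vs[OF span_is_subspace[OF cX]])
  \<comment> \<open>The rank is the dimension of the column space as a vector space of its own, so
    independence has to be transferred into it.\<close>
  interpret W: vectorspace class_ring "span_vs (set (cols X))" by (rule vs)
  have "card (set (cols (X * Y))) \<le> W.dim"
  proof (rule W.li_le_dim(2))
    show "W.fin_dim" using fin_dim_span_cols[OF X] .
    show "set (cols (X * Y)) \<subseteq> carrier (span_vs (set (cols X)))" using sub by simp
    show "W.lin_indpt (set (cols (X * Y)))"
      using span_li_not_depend(2)[OF sub subm] li by simp
  qed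
  then show ?thesis using distinct_card[OF dist] Y unfolding rank_def by simp
qed

end

section \<open>Adjoints, orthonormal columns and diagonal matrices\<close>

lemma mat_adjoint_dim [simp]:
  "dim_row (mat_adjoint A) = dim_col A" "dim_col (mat_adjoint A) = dim_row A"
  unfolding mat_adjoint_def by auto

lemma mat_adjoint_carrier [simp]:
  "A \<in> carrier_mat nr nc \<Longrightarrow> mat_adjoint A \<in> carrier_mat nc nr"
  by (intro carrier_matI) auto

lemma mat_adjoint_index:
  "i < dim_col A \<Longrightarrow> j < dim_row A \<Longrightarrow> mat_adjoint A $$ (i, j) = conjugate (A $$ (j, i))"
  unfolding mat_adjoint_def by (simp add: mat_of_rows_index)

text \<open>The adjoint of \<open>U\<close> is a left inverse.\<close>

lemma orthonormal_cols_inj: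
  assumes U: "U \<in> carrier_mat m d" and on: "orthonormal_cols U"
    and v: "v \<in> carrier_vec d" and z: "U *\<^sub>v v = 0\<^sub>v m"
  shows "v = 0\<^sub>v d"
proof -
  have "v = (mat_adjoint U * U) *\<^sub>v v" using U on v unfolding orthonormal_cols_def by simp
  also have "\<dots> = mat_adjoint U *\<^sub>v (U *\<^sub>v v)"
    by (rule assoc_mult_mat_vec[OF mat_adjoint_carrier[OF U] U v])
  also have "\<dots> = 0\<^sub>v d" unfolding z using U by (intro eq_vecI) auto
  finally show ?thesis .
qed

lemma diagonal_mat_mult_vec_index:
  fixes D :: "'a :: semiring_0 mat"
  assumes D: "D \<in> carrier_mat nr nc" and diag: "diagonal_mat D"
    and w: "w \<in> carrier_vec nc" and c: "c < nr" "c < nc"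
  shows "(D *\<^sub>v w) $ c = D $$ (c, c) * w $ c"
proof -
  have "(D *\<^sub>v w) $ c = (\<Sum>d = 0..<nc. D $$ (c, d) * w $ d)"
    using D w c by (simp add: scalar_prod_def)
  also have "\<dots> = (\<Sum>d = 0..<nc. if d = c then D $$ (c, c) * w $ c else 0)"
    using D diag c by (intro sum.cong) (auto simp: diagonal_mat_def)
  also have "\<dots> = D $$ (c, c) * w $ c" using c by simp
  finally show ?thesis .
qed

section \<open>Rank as the number of nonzero singular values\<close>

text \<open>With \<open>r\<close> nonzero diagonal entries, \<open>D\<close> factors through
  dimension \<open>r\<close>, which bounds the rank above. Restricted to the columns of
  \<open>V\<close> at those positions, the product is injective, which bounds it below.\<close>

lemma rank_of_svd:
  assumes U: "U \<in> carrier_mat m mt" and on: "orthonormal_cols U"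
    and D: "D \<in> carrier_mat mt d" and diag: "diagonal_mat D" and mt: "mt \<le> d"
    and V: "unitary_mat d V"
  shows "vec_space.rank m (U * D * mat_adjoint V) = card {c. c < mt \<and> D $$ (c, c) \<noteq> 0}"
    (is "vec_space.rank m ?M = card ?T")
proof -
  interpret vec_space "TYPE(complex)" m .
  have Vc: "V \<in> carrier_mat d d" and VV: "mat_adjoint V * V = 1\<^sub>m d"
    using V unfolding unitary_mat_def by auto
  note Va = mat_adjoint_carrier[OF Vc]
  have M: "?M \<in> carrier_mat m d" using U D Va by simp
  define r where "r = card ?T"
  have "finite ?T" by simp
  \<comment> \<open>\<open>f\<close> enumerates the positions of the nonzero diagonal
    entries.\<close>
  then obtain f where f: "bij_betw f {0..<r} ?T"
    unfolding r_def using ex_bij_betw_nat_finite by blast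
  have fT: "f a < mt" "D $$ (f a, f a) \<noteq> 0" if "a < r" for a
    using f that by (auto dest: bij_betwE)
  have f_eq: "f a = f b \<longleftrightarrow> a = b" if "a < r" "b < r" for a b
    using f that by (auto simp: bij_betw_def inj_on_def)
  have f_surj: "\<exists>a<r. f a = c" if "c \<in> ?T" for c
    using that unfolding bij_betw_imp_surj_on[OF f, symmetric] by auto
  \<comment> \<open>\<open>E\<close> and \<open>G\<close> place \<open>r\<close> coordinates at the
    positions \<open>f a\<close> of a vector of length \<open>mt\<close> and \<open>d\<close>,
    respectively. \<open>F\<close> reads these positions and scales them by the diagonal
    entries.\<close>
  define E :: "complex mat" where "E = mat mt r (\<lambda>(c, a). if c = f a then 1 else 0)"
  define F :: "complex mat" where "F = mat r d (\<lambda>(a, c). if c = f a then D $$ (c, c) else 0)"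
  define G :: "complex mat" where "G = mat d r (\<lambda>(c, a). if c = f a then 1 else 0)"
  have E: "E \<in> carrier_mat mt r" and F: "F \<in> carrier_mat r d" and G: "G \<in> carrier_mat d r"
    unfolding E_def F_def G_def by auto
  have EF: "E * F = D"
  proof (rule eq_matI)
    fix c e assume "c < dim_row D" "e < dim_col D"
    then have c: "c < mt" and e: "e < d" using D by auto
    have "(E * F) $$ (c, e)
        = (\<Sum>a = 0..<r. (if c = f a then 1 else 0) * (if e = f a then D $$ (e, e) else 0))"
      using c e by (simp add: E_def F_def scalar_prod_def)
    also have "\<dots> = D $$ (c, e)"
    \<comment> \<open>At a nonzero diagonal position exactly one summand survives; elsewhere all
      summands vanish, as does the entry of \<open>D\<close>.\<close>
    proof (cases "c = e \<and> c \<in> ?T")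
      case True
      then obtain b where b: "b < r" "f b = c" using f_surj by blast
      have "(\<Sum>a = 0..<r. (if c = f a then 1 else 0) * (if e = f a then D $$ (e, e) else 0))
          = (\<Sum>a = 0..<r. if a = b then D $$ (c, e) else 0)"
        using b True f_eq by (intro sum.cong) auto
      then show ?thesis using b by simp
    next
      case False
      then have "D $$ (c, e) = 0" using c e D diag by (auto simp: diagonal_mat_def)
      moreover have "(\<Sum>a = 0..<r. (if c = f a then 1 else 0) *
          (if e = f a then D $$ (e, e) else 0)) = 0"
        using False fT by (intro sum.neutral) auto
      ultimately show ?thesis by simp
    qed
    finally show "(E * F) $$ (c, e) = D $$ (c, e)" .
  qed (use D E F in auto)
  have "?M = (U * E) * F * mat_adjoint V"
    unfolding EF[symmetric] using assoc_mult_mat[OF U E F] by simp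
  also have "\<dots> = (U * E) * (F * mat_adjoint V)"
    using U E F Va by (intro assoc_mult_mat) auto
  finally have "?M = (U * E) * (F * mat_adjoint V)" .
  then have le: "rank ?M \<le> r"
    using rank_mult_le_inner_dim[of "U * E" r "F * mat_adjoint V" d] U E F Va by simp
  have "r \<le> rank ?M"
  \<comment> \<open>The factor \<open>V\<close> cancels its adjoint and leaves
    \<open>U * D * G\<close>, where \<open>D\<close> acts on the image of \<open>G\<close> by
    nonzero scalars.\<close>
  proof (rule inj_mult_le_rank[OF M, of "V * G"])
    show "V * G \<in> carrier_mat d r" using Vc G by simp
    fix v :: "complex vec" assume v: "v \<in> carrier_vec r" and z: "?M * (V * G) *\<^sub>v v = 0\<^sub>v m"
    define w where "w = G *\<^sub>v v"
    have w: "w \<in> carrier_vec d" unfolding w_def using G v by simp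
    have "?M * (V * G) = U * D * (mat_adjoint V * (V * G))"
      using U D Va Vc G by (intro assoc_mult_mat) auto
    also have "mat_adjoint V * (V * G) = mat_adjoint V * V * G"
      using Va Vc G by (intro assoc_mult_mat[symmetric]) auto
    also have "\<dots> = G" using VV G by simp
    finally have "U * D * G *\<^sub>v v = 0\<^sub>v m" using z by simp
    also have "U * D * G *\<^sub>v v = U * D *\<^sub>v w"
      unfolding w_def using U D G v by (intro assoc_mult_mat_vec) auto
    also have "\<dots> = U *\<^sub>v (D *\<^sub>v w)" using U D w by (intro assoc_mult_mat_vec) auto
    finally have Dw: "D *\<^sub>v w = 0\<^sub>v mt"
      using orthonormal_cols_inj[OF U on, of "D *\<^sub>v w"] D w by simp
    show "v = 0\<^sub>v r"
    proof (rule eq_vecI)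
      fix a assume "a < dim_vec (0\<^sub>v r :: complex vec)"
      then have a: "a < r" by simp
      have fa: "f a < mt" "f a < d" using fT(1)[OF a] mt by auto
      have "w $ f a = (\<Sum>b = 0..<r. (if f a = f b then 1 else 0) * v $ b)"
        using fa v by (simp add: w_def G_def scalar_prod_def)
      also have "\<dots> = (\<Sum>b = 0..<r. if b = a then v $ a else 0)"
        using f_eq a by (intro sum.cong) auto
      also have "\<dots> = v $ a" using a by simp
      finally have "D $$ (f a, f a) * v $ a = (D *\<^sub>v w) $ f a"
        using diagonal_mat_mult_vec_index[OF D diag w fa] by simp
      then show "v $ a = (0\<^sub>v r :: complex vec) $ a" using fT[OF a] a Dw by simp
    qed (use v in simp)
  qed
  with le show ?thesis unfolding r_def by simp
qed

section \<open>Block matrices and stacked vectors\<close>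

lemma block_index_less:
  assumes "r < l" "b < n"
  shows "r * n + b < l * (n :: nat)"
proof -
  have "r * n + b < Suc r * n" using assms by simp
  also have "\<dots> \<le> l * n" using assms by (intro mult_right_mono) auto
  finally show ?thesis .
qed

lemma hconcat_index:
  assumes "\<And>M. M \<in> set Ms \<Longrightarrow> M \<in> carrier_mat m n"
    and r: "r < length Ms" and a: "a < m" and b: "b < n"
  shows "hconcat m Ms $$ (a, r * n + b) = (Ms ! r) $$ (a, b)"
proof -
  have len: "length (concat (map cols Ms)) = length Ms * n"
    using assms(1) by (induction Ms) auto
  have nth: "concat (map cols Ms) ! (r * n + b) = cols (Ms ! r) ! b"
    using assms(1) r
  proof (induction Ms arbitrary: r)
    case (Cons M Ms)
    have M: "M \<in> carrier_mat m n" using Cons.prems by simp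
    show ?case
    proof (cases r)
      case 0
      then show ?thesis using b M by (simp add: nth_append)
    next
      case (Suc r')
      have "concat (map cols (M # Ms)) ! (Suc r' * n + b) = concat (map cols Ms) ! (r' * n + b)"
        using M by (simp add: nth_append)
      also have "\<dots> = cols (Ms ! r') ! b" using Cons Suc by simp
      finally show ?thesis using Suc by simp
    qed
  qed simp
  have lt: "r * n + b < length Ms * n" using block_index_less[OF r b] .
  have "Ms ! r \<in> carrier_mat m n" using assms(1) r by simp
  then show ?thesis unfolding hconcat_def using nth len lt a b by (simp add: mat_of_cols_index)
qed

lemma hconcat_carrier:
  "hconcat m Ms \<in> carrier_mat m (\<Sum>M\<leftarrow>Ms. dim_col M)"
  unfolding hconcat_def by (auto simp: length_concat o_def)

text \<open>\<open>j div n\<close> is the block and \<open>j mod n\<close> the position in it; block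
  0 carries \<open>x\<close> itself. For \<open>n = 0\<close> the vector is empty, so the division
  by zero is harmless.\<close>

definition stacked_vec :: "nat \<Rightarrow> nat \<Rightarrow> (nat \<Rightarrow> 'a) \<Rightarrow> 'a vec \<Rightarrow> 'a :: ring_1 vec" where
  "stacked_vec k n lam x =
    vec ((k + 1) * n) (\<lambda>j. (if j div n = 0 then 1 else - lam (j div n)) * x $ (j mod n))"

text \<open>The minus signs in the stacked vector move the right-hand side across. Since
  \<open>W\<close> is given only through its blocks, the lemma serves both the rectangular problem
  and the square one.\<close>

lemma block_row_mult_stacked_vec_iff:
  fixes A :: "'a :: comm_ring_1 mat"
  assumes W: "W \<in> carrier_mat p ((k + 1) * n)" and A: "A \<in> carrier_mat p n"
    and B: "\<And>s. s \<in> {1..k} \<Longrightarrow> B s \<in> carrier_mat p n" and x: "x \<in> carrier_vec n"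
    and WA: "\<And>a b. a < p \<Longrightarrow> b < n \<Longrightarrow> W $$ (a, b) = A $$ (a, b)"
    and WB: "\<And>a b s. a < p \<Longrightarrow> b < n \<Longrightarrow> s \<in> {1..k} \<Longrightarrow> W $$ (a, s * n + b) = B s $$ (a, b)"
  shows "W *\<^sub>v stacked_vec k n lam x = 0\<^sub>v p \<longleftrightarrow>
    A *\<^sub>v x = finsum_vec TYPE('a) p (\<lambda>s. lam s \<cdot>\<^sub>v (B s *\<^sub>v x)) {1..k}"
    (is "?l = 0\<^sub>v p \<longleftrightarrow> _ = ?R")
proof -
  have Bx: "(\<lambda>s. lam s \<cdot>\<^sub>v (B s *\<^sub>v x)) \<in> {1..k} \<rightarrow> carrier_vec p"
    using mult_mat_vec_carrier[OF B x] by auto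
  have R: "?R \<in> carrier_vec p" by (rule finsum_vec_closed[OF Bx])
  have "?l $ a = (A *\<^sub>v x) $ a - ?R $ a" if a: "a < p" for a
  proof -
    define g where "g j = W $$ (a, j) * stacked_vec k n lam x $ j" for j
    \<comment> \<open>Reindexes a block from the interval form in which \<open>sum.nat_group\<close>
      splits the long sum.\<close>
    have blk: "(\<Sum>j = r * n..<r * n + n. g j) = (\<Sum>b = 0..<n. g (r * n + b))" for r
      using sum.shift_bounds_nat_ivl[of g 0 "r * n" n] by (simp add: add.commute)
    have g0: "(\<Sum>b = 0..<n. g b) = (A *\<^sub>v x) $ a"
      using a A x WA by (auto simp: scalar_prod_def g_def stacked_vec_def intro!: sum.cong)
    have gs: "(\<Sum>b = 0..<n. g (s * n + b)) = - (lam s * (B s *\<^sub>v x) $ a)" if s: "s \<in> {1..k}" for s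
    proof -
      have "g (s * n + b) = - (lam s * (B s $$ (a, b) * x $ b))" if b: "b < n" for b
      proof -
        have "s * n + b < (k + 1) * n" using block_index_less[of s "k + 1" b n] s b by simp
        then show ?thesis
          unfolding g_def stacked_vec_def using s b WB[OF a b s] by simp
      qed
      then have "(\<Sum>b = 0..<n. g (s * n + b)) = - (lam s * (\<Sum>b = 0..<n. B s $$ (a, b) * x $ b))"
        by (simp add: sum_negf sum_distrib_left)
      also have "(\<Sum>b = 0..<n. B s $$ (a, b) * x $ b) = (B s *\<^sub>v x) $ a"
        using a B[OF s] x by (simp add: scalar_prod_def)
      finally show ?thesis .
    qed
    have smult: "(lam s \<cdot>\<^sub>v (B s *\<^sub>v x)) $ a = lam s * (B s *\<^sub>v x) $ a" if "s \<in> {1..k}" for s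
      using a B[OF that] by simp
    have "?l $ a = (\<Sum>j<(k + 1) * n. g j)"
      using a W by (auto simp: scalar_prod_def g_def stacked_vec_def atLeast0LessThan intro!: sum.cong)
    also have "\<dots> = (\<Sum>r<k + 1. \<Sum>b = 0..<n. g (r * n + b))"
      unfolding sum.nat_group[symmetric] blk ..
    also have "\<dots> = (\<Sum>r\<in>insert 0 {1..k}. \<Sum>b = 0..<n. g (r * n + b))"
      by (intro sum.cong) auto
    also have "\<dots> = (A *\<^sub>v x) $ a + (\<Sum>s\<in>{1..k}. - (lam s * (B s *\<^sub>v x) $ a))"
      using g0 gs by simp
    also have "(\<Sum>s\<in>{1..k}. - (lam s * (B s *\<^sub>v x) $ a)) = - ?R $ a"
      using index_finsum_vec[OF _ a Bx] smult by (simp add: sum_negf)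
    finally show ?thesis by simp
  qed
  then have "(\<forall>a<p. ?l $ a = 0) \<longleftrightarrow> (\<forall>a<p. (A *\<^sub>v x) $ a = ?R $ a)" by simp
  moreover have "?l = 0\<^sub>v p \<longleftrightarrow> (\<forall>a<p. ?l $ a = 0)" using W by (auto simp: vec_eq_iff)
  moreover have "A *\<^sub>v x = ?R \<longleftrightarrow> (\<forall>a<p. (A *\<^sub>v x) $ a = ?R $ a)"
    using A R by (auto simp: vec_eq_iff)
  ultimately show ?thesis by simp
qed

section \<open>The kernel in terms of singular values\<close>

text \<open>Merges the blocks into a single diagonal matrix. The ordering of the singular values
  survives as a statement on zeros: a nonzero entry from position \<open>n\<close> on makes all
  first \<open>n\<close> entries nonzero.\<close>

lemma partitioned_svdE:
  assumes svd: "partitioned_svd m n k M U1 U2 S1 S2 V" and nm: "n \<le> m"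
  obtains U D where "U \<in> carrier_mat m (min m ((k + 1) * n))" "orthonormal_cols U"
    "D \<in> carrier_mat (min m ((k + 1) * n)) ((k + 1) * n)" "diagonal_mat D"
    "unitary_mat ((k + 1) * n) V" "M = U * D * mat_adjoint V"
    "\<And>j l. j < n \<Longrightarrow> n \<le> l \<Longrightarrow> l < min m ((k + 1) * n) \<Longrightarrow> D $$ (l, l) \<noteq> 0 \<Longrightarrow> D $$ (j, j) \<noteq> 0"
proof -
  define mt where "mt = min m ((k + 1) * n)"
  define U where "U = hconcat m [U1, U2]"
  define S where "S = four_block_mat S1 (0\<^sub>m n (k * n)) (0\<^sub>m (mt - n) n) S2"
  define D where "D = map_mat complex_of_real S"
  note svd' = svd[unfolded partitioned_svd_def Let_def, folded mt_def, folded U_def S_def]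
  have mt: "n \<le> mt" "mt \<le> (k + 1) * n" unfolding mt_def using nm by auto
  have S1: "S1 \<in> carrier_mat n n" "diagonal_mat S1" and S2: "S2 \<in> carrier_mat (mt - n) (k * n)" "diagonal_mat S2"
    and nonneg: "\<forall>l<mt - n. 0 \<le> S2 $$ (l, l)"
    and ord: "\<forall>j<n. \<forall>l<mt - n. S2 $$ (l, l) \<le> S1 $$ (j, j)" using svd' by auto
  have U: "U \<in> carrier_mat m mt"
    using hconcat_carrier[of m "[U1, U2]"] svd' mt unfolding U_def by auto
  have Sc: "S \<in> carrier_mat mt ((k + 1) * n)"
    using four_block_carrier_mat[OF S1(1) S2(1)] mt unfolding S_def by simp
  then have D: "D \<in> carrier_mat mt ((k + 1) * n)" unfolding D_def by simp
  have Sidx: "S $$ (c, e) = (if c < n then if e < n then S1 $$ (c, e) else 0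
      else if e < n then 0 else S2 $$ (c - n, e - n))" if "c < mt" "e < (k + 1) * n" for c e
    using that S1(1) S2(1) mt unfolding S_def by simp
  have "S $$ (c, e) = 0" if ce: "c < mt" "e < (k + 1) * n" "c \<noteq> e" for c e
    using ce S1 S2 by (auto simp: Sidx diagonal_mat_def)
  then have diag: "diagonal_mat D" using Sc unfolding D_def diagonal_mat_def by auto
  \<comment> \<open>Entry \<open>l\<close> of \<open>D\<close> is entry \<open>l - n\<close> of
    \<open>S2\<close>. Being nonnegative and nonzero it is positive, and every diagonal entry of
    \<open>S1\<close> dominates it.\<close>
  have "D $$ (j, j) \<noteq> 0" if j: "j < n" and l: "n \<le> l" "l < mt" and nz: "D $$ (l, l) \<noteq> 0" for j l
  proof -
    have S2nz: "S2 $$ (l - n, l - n) \<noteq> 0" using nz l mt Sc Sidx[of l l] unfolding D_def by auto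
    have "l - n < mt - n" using l by simp
    then have "0 \<le> S2 $$ (l - n, l - n)" "S2 $$ (l - n, l - n) \<le> S1 $$ (j, j)"
      using nonneg ord j by auto
    with S2nz have "S1 $$ (j, j) > 0" by linarith
    then show ?thesis using j mt Sc Sidx[of j j] unfolding D_def by auto
  qed
  with that[of U D] show ?thesis using U D diag svd' unfolding mt_def[symmetric] D_def by auto
qed

text \<open>\<open>W\<close> consists of the first \<open>n\<close> rows of the adjoint of
  \<open>V\<close>, so \<open>W *\<^sub>v z\<close> is the head of the coordinate vector
  \<open>w\<close> of \<open>z\<close>.\<close>

lemma svd_kernel:
  assumes svd: "partitioned_svd m n k M U1 U2 S1 S2 V" and nm: "n \<le> m"
    and z: "z \<in> carrier_vec ((k + 1) * n)"
  defines "W \<equiv> mat n ((k + 1) * n) (\<lambda>(a, j). conjugate (V $$ (j, a)))"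
  shows "vec_space.rank m M \<le> n \<Longrightarrow> W *\<^sub>v z = 0\<^sub>v n \<Longrightarrow> M *\<^sub>v z = 0\<^sub>v m"
    and "n \<le> vec_space.rank m M \<Longrightarrow> M *\<^sub>v z = 0\<^sub>v m \<Longrightarrow> W *\<^sub>v z = 0\<^sub>v n"
proof -
  define d where "d = (k + 1) * n"
  define mt where "mt = min m d"
  have mt: "n \<le> mt" "mt \<le> d" "n \<le> d" unfolding mt_def d_def using nm by auto
  obtain U D where U: "U \<in> carrier_mat m mt" and on: "orthonormal_cols U"
    and D: "D \<in> carrier_mat mt d" and diag: "diagonal_mat D" and V: "unitary_mat d V"
    and M: "M = U * D * mat_adjoint V"
    and ord: "\<And>j l. j < n \<Longrightarrow> n \<le> l \<Longrightarrow> l < mt \<Longrightarrow> D $$ (l, l) \<noteq> 0 \<Longrightarrow> D $$ (j, j) \<noteq> 0"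
    using partitioned_svdE[OF svd nm] unfolding mt_def d_def by metis
  define T where "T = {c. c < mt \<and> D $$ (c, c) \<noteq> 0}"
  have fin: "finite T" unfolding T_def by simp
  have rank: "vec_space.rank m M = card T"
    unfolding M T_def by (rule rank_of_svd[OF U on D diag mt(2) V])
  have Vc: "V \<in> carrier_mat d d" using V unfolding unitary_mat_def by simp
  note Va = mat_adjoint_carrier[OF Vc]
  have z: "z \<in> carrier_vec d" using z unfolding d_def .
  define w where "w = mat_adjoint V *\<^sub>v z"
  have w: "w \<in> carrier_vec d" unfolding w_def using Va z by simp
  have Wz: "W *\<^sub>v z = vec n (\<lambda>a. w $ a)"
    unfolding W_def w_def d_def[symmetric] using Vc z mt
    by (intro eq_vecI) (auto simp: scalar_prod_def mat_adjoint_index)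
  have Mz: "M *\<^sub>v z = U *\<^sub>v (D *\<^sub>v w)"
  proof -
    have "M *\<^sub>v z = U * D *\<^sub>v w"
      unfolding M w_def using U D Va z by (intro assoc_mult_mat_vec) auto
    also have "\<dots> = U *\<^sub>v (D *\<^sub>v w)" using U D w by (intro assoc_mult_mat_vec) auto
    finally show ?thesis .
  qed
  have Dw: "(D *\<^sub>v w) $ c = D $$ (c, c) * w $ c" if "c < mt" for c
    using diagonal_mat_mult_vec_index[OF D diag w] that mt by simp
  {
    assume r: "vec_space.rank m M \<le> n" and W0: "W *\<^sub>v z = 0\<^sub>v n"
    \<comment> \<open>Otherwise \<open>T\<close> would contain \<open>l\<close> together with all
      positions below \<open>n\<close>, hence at least \<open>n + 1\<close> elements.\<close>
    have tail: "D $$ (l, l) = 0" if l: "n \<le> l" "l < mt" for l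
    proof (rule ccontr)
      assume nz: "D $$ (l, l) \<noteq> 0"
      have "insert l {..<n} \<subseteq> T" using ord[OF _ l nz] l nz unfolding T_def by auto
      then have "card (insert l {..<n}) \<le> card T" by (rule card_mono[OF fin])
      then show False using l r rank by simp
    qed
    have head: "w $ c = 0" if c: "c < n" for c
      using arg_cong[OF W0, of "\<lambda>v. v $ c"] c unfolding Wz by simp
    have "D *\<^sub>v w = 0\<^sub>v mt"
    proof (rule eq_vecI)
      fix c assume "c < dim_vec (0\<^sub>v mt :: complex vec)"
      then show "(D *\<^sub>v w) $ c = 0\<^sub>v mt $ c" using Dw tail head by (cases "c < n") auto
    qed (use D in simp)
    then show "M *\<^sub>v z = 0\<^sub>v m" unfolding Mz using U by (intro eq_vecI) auto
  next
    assume r: "n \<le> vec_space.rank m M" and M0: "M *\<^sub>v z = 0\<^sub>v m"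
    \<comment> \<open>A zero at \<open>j\<close> would force zeros from position \<open>n\<close>
      on, leaving \<open>T\<close> fewer than \<open>n\<close> elements.\<close>
    have head: "D $$ (j, j) \<noteq> 0" if j: "j < n" for j
    proof
      assume zero: "D $$ (j, j) = 0"
      have "T \<subseteq> {..<n} - {j}"
      proof
        fix c assume "c \<in> T"
        then show "c \<in> {..<n} - {j}"
          using ord[OF j, of c] zero unfolding T_def by (cases "n \<le> c") auto
      qed
      then have "card T \<le> card ({..<n} - {j})" by (rule card_mono[rotated]) simp
      then show False using j r rank by simp
    qed
    have "D *\<^sub>v w = 0\<^sub>v mt"
      using orthonormal_cols_inj[OF U on] M0 D w unfolding Mz by simp
    then have "D $$ (c, c) * w $ c = 0" if "c < n" for c
      using Dw[of c] that mt by simp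
    then show "W *\<^sub>v z = 0\<^sub>v n" unfolding Wz using head by (intro eq_vecI) auto
  }
qed

section \<open>Both eigenvalue problems as kernel conditions\<close>

lemma coeff_mat_stacked_vec_iff:
  fixes A :: "'a :: comm_ring_1 mat"
  assumes A: "A \<in> carrier_mat m n" and B: "\<And>s. s \<in> {1..k} \<Longrightarrow> B s \<in> carrier_mat m n"
    and x: "x \<in> carrier_vec n"
  shows "coeff_mat m k A B *\<^sub>v stacked_vec k n lam x = 0\<^sub>v m \<longleftrightarrow>
    A *\<^sub>v x = finsum_vec TYPE('a) m (\<lambda>s. lam s \<cdot>\<^sub>v (B s *\<^sub>v x)) {1..k}"
proof (rule block_row_mult_stacked_vec_iff[OF _ A B x])
  let ?Ms = "A # map B [1..<Suc k]"
  have Ms: "M \<in> carrier_mat m n" if "M \<in> set ?Ms" for M using that A B by auto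
  have "(\<Sum>M\<leftarrow>?Ms. dim_col M) = (\<Sum>M\<leftarrow>?Ms. n)"
    by (rule arg_cong[where f = sum_list], rule map_cong[OF refl]) (use Ms in auto)
  also have "\<dots> = (k + 1) * n" by (simp add: sum_list_triv o_def del: upt_Suc)
  finally show "coeff_mat m k A B \<in> carrier_mat m ((k + 1) * n)"
    using hconcat_carrier[of m ?Ms] unfolding coeff_mat_def by simp
  fix a b assume a: "a < m" and b: "b < n"
  show "coeff_mat m k A B $$ (a, b) = A $$ (a, b)"
    using hconcat_index[of ?Ms m n 0 a b] Ms a b unfolding coeff_mat_def by simp
  fix s assume s: "s \<in> {1..k}"
  \<comment> \<open>Position 0 of the list holds \<open>A\<close>, and the remaining indices start
    at 1, so the two shifts cancel.\<close>
  then have "?Ms ! s = B s" by (cases s) (auto simp del: upt_Suc)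
  then show "coeff_mat m k A B $$ (a, s * n + b) = B s $$ (a, b)"
    using hconcat_index[of ?Ms m n s a b] Ms a b s unfolding coeff_mat_def by simp
qed

text \<open>Conjugate transposition turns the first block column of \<open>V\<close> into a block
  row whose blocks are the square coefficient matrices.\<close>

lemma adjoint_blocks_stacked_vec_iff:
  fixes V :: "complex mat"
  assumes x: "x \<in> carrier_vec n"
  shows "mat n ((k + 1) * n) (\<lambda>(a, j). conjugate (V $$ (j, a))) *\<^sub>v stacked_vec k n lam x = 0\<^sub>v n \<longleftrightarrow>
    mat_adjoint (first_col_block n 1 V) *\<^sub>v x =
    finsum_vec TYPE(complex) n
      (\<lambda>s. lam s \<cdot>\<^sub>v (mat_adjoint (first_col_block n (s + 1) V) *\<^sub>v x)) {1..k}"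
proof (rule block_row_mult_stacked_vec_iff[OF _ _ _ x])
  have blk: "first_col_block n r V \<in> carrier_mat n n" for r unfolding first_col_block_def by simp
  then show "mat_adjoint (first_col_block n 1 V) \<in> carrier_mat n n"
    and "\<And>s. mat_adjoint (first_col_block n (s + 1) V) \<in> carrier_mat n n" by auto
  have lt: "s * n + b < (k + 1) * n" if "s \<le> k" "b < n" for s b
    using block_index_less[of s "k + 1" b n] that by simp
  fix a b assume a: "a < n" and b: "b < n"
  show "mat n ((k + 1) * n) (\<lambda>(a, j). conjugate (V $$ (j, a))) $$ (a, b) =
      mat_adjoint (first_col_block n 1 V) $$ (a, b)"
    using lt[of 0 b] a b by (simp add: mat_adjoint_index first_col_block_def)
  \<comment> \<open>\<open>first_col_block\<close> counts block rows from 1, so block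
    \<open>s + 1\<close> starts at row \<open>s * n\<close>.\<close>
  fix s assume "s \<in> {1..k}"
  then show "mat n ((k + 1) * n) (\<lambda>(a, j). conjugate (V $$ (j, a))) $$ (a, s * n + b) =
      mat_adjoint (first_col_block n (s + 1) V) $$ (a, b)"
    using lt[of s b] a b by (simp add: mat_adjoint_index first_col_block_def)
qed simp

section \<open>Comparison of the two solution sets\<close>

theorem theorem5p4:
  fixes k :: nat and m n :: "nat \<Rightarrow> nat"
    and A At :: "nat \<Rightarrow> complex mat" and B Bt :: "nat \<Rightarrow> nat \<Rightarrow> complex mat"
    and U1 U2 V :: "nat \<Rightarrow> complex mat" and S1 S2 :: "nat \<Rightarrow> real mat"
  assumes "k \<ge> 1"
    and "\<And>i. i \<in> {1..k} \<Longrightarrow> n i \<le> m i"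
    and "\<And>i. i \<in> {1..k} \<Longrightarrow> A i \<in> carrier_mat (m i) (n i)"
    and "\<And>i s. i \<in> {1..k} \<Longrightarrow> s \<in> {1..k} \<Longrightarrow> B i s \<in> carrier_mat (m i) (n i)"
    and "\<And>i. i \<in> {1..k} \<Longrightarrow>
      partitioned_svd (m i) (n i) k (coeff_mat (m i) k (A i) (B i)) (U1 i) (U2 i) (S1 i) (S2 i) (V i)"
    and "\<And>i. i \<in> {1..k} \<Longrightarrow> At i = mat_adjoint (first_col_block (n i) 1 (V i))"
    and "\<And>i s. i \<in> {1..k} \<Longrightarrow> s \<in> {1..k} \<Longrightarrow>
      Bt i s = mat_adjoint (first_col_block (n i) (s + 1) (V i))"
  shows "((\<forall>i\<in>{1..k}. vec_space.rank (m i) (coeff_mat (m i) k (A i) (B i)) \<le> n i) \<longrightarrow>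
            mep_solutions k n n At Bt \<subseteq> mep_solutions k m n A B) \<and>
         ((\<forall>i\<in>{1..k}. vec_space.rank (m i) (coeff_mat (m i) k (A i) (B i)) \<ge> n i) \<longrightarrow>
            mep_solutions k m n A B \<subseteq> mep_solutions k n n At Bt) \<and>
         ((\<forall>i\<in>{1..k}. vec_space.rank (m i) (coeff_mat (m i) k (A i) (B i)) = n i) \<longrightarrow>
            mep_solutions k n n At Bt = mep_solutions k m n A B)"
proof -
  let ?M = "\<lambda>i. coeff_mat (m i) k (A i) (B i)"
  have At: "At i *\<^sub>v y = finsum_vec TYPE(complex) (n i) (\<lambda>s. lam s \<cdot>\<^sub>v (Bt i s *\<^sub>v y)) {1..k} \<longleftrightarrow>
      mat (n i) ((k + 1) * n i) (\<lambda>(a, j). conjugate (V i $$ (j, a))) *\<^sub>v stacked_vec k (n i) lam y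
        = 0\<^sub>v (n i)" if i: "i \<in> {1..k}" and y: "y \<in> carrier_vec (n i)" for i lam y
  proof -
    \<comment> \<open>\<open>Bt i s\<close> is prescribed only for \<open>s\<close> in
      \<open>{1..k}\<close>, so the sums are compared termwise over that range.\<close>
    have "finsum_vec TYPE(complex) (n i) (\<lambda>s. lam s \<cdot>\<^sub>v (Bt i s *\<^sub>v y)) {1..k} =
      finsum_vec TYPE(complex) (n i) (\<lambda>s. lam s \<cdot>\<^sub>v
        (mat_adjoint (first_col_block (n i) (s + 1) (V i)) *\<^sub>v y)) {1..k}"
    proof -
      interpret vec_space "TYPE(complex)" "n i" .
      show ?thesis unfolding finsum_vec
        by (rule M.finsum_cong') (auto simp: assms(7)[OF i] first_col_block_def intro!: carrier_vecI)
    qed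
    then show ?thesis using adjoint_blocks_stacked_vec_iff[OF y] assms(6)[OF i] by simp
  qed
  have RMEP: "A i *\<^sub>v y = finsum_vec TYPE(complex) (m i) (\<lambda>s. lam s \<cdot>\<^sub>v (B i s *\<^sub>v y)) {1..k} \<longleftrightarrow>
      ?M i *\<^sub>v stacked_vec k (n i) lam y = 0\<^sub>v (m i)"
    if i: "i \<in> {1..k}" and y: "y \<in> carrier_vec (n i)" for i lam y
    using coeff_mat_stacked_vec_iff[OF assms(3)[OF i] assms(4)[OF i] y] by simp
  have z: "stacked_vec k d lam y \<in> carrier_vec ((k + 1) * d)" for d lam and y :: "complex vec"
    unfolding stacked_vec_def by simp
  note kernel = svd_kernel[OF assms(5,2) z]
  \<comment> \<open>The conditions on \<open>lam\<close> and \<open>x\<close>, including nonzero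
    \<open>x i\<close> of length \<open>n i\<close>, are the same in both sets; only the equations
    have to be transferred, separately for each \<open>i\<close>.\<close>
  have one: "mep_solutions k n n At Bt \<subseteq> mep_solutions k m n A B"
    if "\<forall>i\<in>{1..k}. vec_space.rank (m i) (?M i) \<le> n i"
    unfolding mep_solutions_def using that kernel(1) At RMEP by (fastforce simp: PiE_iff)
  have two: "mep_solutions k m n A B \<subseteq> mep_solutions k n n At Bt"
    if "\<forall>i\<in>{1..k}. vec_space.rank (m i) (?M i) \<ge> n i"
    unfolding mep_solutions_def using that kernel(2) At RMEP by (fastforce simp: PiE_iff)
  from one two show ?thesis by (simp add: subset_antisym)
qed

end
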